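(* Let $\vartheta$ be a primitive compatible random substitution on an alphabet $\mathcal{A}=\{a_1,\dots,a_d\}$ whose second eigenvalue $\lambda_2$ is less than $1$ in modulus. Then the associated RS-tiling space $\Omega_\vartheta$ is not topologically mixing.
   Context: Random substitutions. $\mathcal{A}^+$ is the set of non-empty finite words over the finite alphabet $\mathcal{A}$. A random substitution $\vartheta$ assigns to each $a\in\mathcal{A}$ a non-empty finite set $\vartheta(a)\subset\mathcal{A}^+$. It extends to words by $\vartheta(v_1\cdots v_m)=\{w_1\cdots w_m : w_i\in\vartheta(v_i)\}$ and to sets of words by $\vartheta(B)=\bigcup_{w\in B}\vartheta(w)$, so the powers $\vartheta^k$ are defined. A word is $\vartheta$-legal if it is a (contiguous) subword of some element of $\vartheta^k(a)$ for some $k\ge 1$, $a\in\mathcal{A}$. $\vartheta$ is compatible if, for each $a\in\mathcal{A}$, all words in $\vartheta(a)$ have the same number of occurrences of each letter; then the substitution matrix $M_\vartheta$ has $(i,j)$ entry equal to the common number of $a_i$'s in the words of $\vartheta(a_j)$. $\vartheta$ is primitive if some power of $M_\vartheta$ has all entries positive. $\lambda_1$ is the Perron–Frobenius eigenvalue of $M_\vartheta$ and the second eigenvalue $\lambda_2$ is an eigenvalue of largest modulus among the remaining ones (so $d\ge2$, and $|\lambda_2|<1$ means all eigenvalues other than $\lambda_1$ have modulus less than $1$). Tiling spaces. To each letter $a_i$ associate a labelled interval (tile) of some length $\ell(a_i)>0$. To a (possibly infinite) word associate the patch obtained by laying the corresponding tiles end to end; a tiling is a bi-infinite patch covering $\mathbb{R}$.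 A finite patch is $\vartheta$-legal if its word is $\vartheta$-legal. $\Omega_\vartheta$ is the set of all tilings (with arbitrary position of the origin) all of whose finite patches are $\vartheta$-legal. $\mathbb{R}$ acts by translation, $T^t(\mathcal{T})=\mathcal{T}-t$, moving all tiles a distance $t$ to the left. The topology has as basis the cylinder sets $\mathcal{Z}_{P,U}=\{\mathcal{S}\in\Omega_\vartheta : P\subset\mathcal{S}-y\text{ for some }y\in U\}$, with $P$ a finite patch at a specified location and $U\subset\mathbb{R}$ open. $(\Omega_\vartheta,T)$ is topologically mixing if for any two non-empty open sets $\mathcal{Z}_1,\mathcal{Z}_2$ there is $R$ such that $T^t(\mathcal{Z}_1)\cap\mathcal{Z}_2\ne\varnothing$ for all $t>R$. *)

theory Defs
  imports
    "HOL-Analysis.Abstract_Topology"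
    "HOL-Library.Sublist"
    "HOL-Computational_Algebra.Computational_Algebra"
    "Jordan_Normal_Form.Spectral_Radius"
begin

section \<open>Random substitutions\<close>

definition random_substitution :: "'a set \<Rightarrow> ('a \<Rightarrow> 'a list set) \<Rightarrow> bool" where
  "random_substitution A \<theta> \<longleftrightarrow> finite A \<and>
     (\<forall>a\<in>A. \<theta> a \<noteq> {} \<and> finite (\<theta> a) \<and> \<theta> a \<subseteq> lists A - {[]})"

definition subst_word :: "('a \<Rightarrow> 'a list set) \<Rightarrow> 'a list \<Rightarrow> 'a list set" where
  "subst_word \<theta> v = concat ` listset (map \<theta> v)"

definition subst_set :: "('a \<Rightarrow> 'a list set) \<Rightarrow> 'a list set \<Rightarrow> 'a list set" where
  "subst_set \<theta> B = (\<Union>w\<in>B. subst_word \<theta> w)"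

definition legal_word :: "'a set \<Rightarrow> ('a \<Rightarrow> 'a list set) \<Rightarrow> 'a list \<Rightarrow> bool" where
  "legal_word A \<theta> u \<longleftrightarrow> (\<exists>k\<ge>1. \<exists>a\<in>A. \<exists>w\<in>(subst_set \<theta> ^^ k) {[a]}. sublist u w)"

definition compatible :: "'a set \<Rightarrow> ('a \<Rightarrow> 'a list set) \<Rightarrow> bool" where
  "compatible A \<theta> \<longleftrightarrow>
     (\<forall>a\<in>A. \<forall>u\<in>\<theta> a. \<forall>v\<in>\<theta> a. \<forall>b\<in>A. count_list u b = count_list v b)"

text \<open>The alphabet is enumerated by a distinct list; rows and columns of the matrix follow
  this enumeration. The entries are meaningful only for compatible random substitutions.\<close>

definition substitution_matrix :: "'a list \<Rightarrow> ('a \<Rightarrow> 'a list set) \<Rightarrow> nat mat" where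
  "substitution_matrix as \<theta> = mat (length as) (length as)
     (\<lambda>(i, j). THE n. \<forall>w\<in>\<theta> (as ! j). count_list w (as ! i) = n)"

definition primitive_substitution :: "'a list \<Rightarrow> ('a \<Rightarrow> 'a list set) \<Rightarrow> bool" where
  "primitive_substitution as \<theta> \<longleftrightarrow>
     (\<exists>k\<ge>1. \<forall>i<length as. \<forall>j<length as. (substitution_matrix as \<theta> ^\<^sub>m k) $$ (i, j) > 0)"

text \<open>For a primitive matrix the Perron--Frobenius eigenvalue is the spectral radius. The
  remaining eigenvalues are counted with algebraic multiplicity, so exactly one copy of it is
  removed. A second eigenvalue need not be unique, as several may share the largest modulus, and
  none exists for a one-letter alphabet.\<close>

definition perron_frobenius_eigenvalue :: "nat mat \<Rightarrow> real" where
  "perron_frobenius_eigenvalue M = spectral_radius (map_mat of_nat M)"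

definition remaining_eigenvalues :: "nat mat \<Rightarrow> complex multiset" where
  "remaining_eigenvalues M =
     proots (char_poly (map_mat of_nat M)) - {# complex_of_real (perron_frobenius_eigenvalue M) #}"

definition second_eigenvalue :: "nat mat \<Rightarrow> complex \<Rightarrow> bool" where
  "second_eigenvalue M \<mu> \<longleftrightarrow>
     \<mu> \<in># remaining_eigenvalues M \<and> (\<forall>\<nu>\<in>#remaining_eigenvalues M. cmod \<nu> \<le> cmod \<mu>)"

section \<open>Tilings\<close>

text \<open>A tile is a pair (x, a), standing for the interval from x to x + len a with label a.
  Patches and tilings are sets of tiles.\<close>

type_synonym 'a tile = "real \<times> 'a"

fun word_patch :: "('a \<Rightarrow> real) \<Rightarrow> real \<Rightarrow> 'a list \<Rightarrow> 'a tile set" where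
  "word_patch len x [] = {}"
| "word_patch len x (a # u) = insert (x, a) (word_patch len (x + len a) u)"

definition is_tiling :: "'a set \<Rightarrow> ('a \<Rightarrow> real) \<Rightarrow> 'a tile set \<Rightarrow> bool" where
  "is_tiling A len S \<longleftrightarrow>
     (\<exists>(w :: int \<Rightarrow> 'a) (p :: int \<Rightarrow> real).
        (\<forall>i. w i \<in> A) \<and> (\<forall>i. p (i + 1) = p i + len (w i)) \<and> S = range (\<lambda>i. (p i, w i))) \<and>
     (\<Union>(x, a)\<in>S. {x..x + len a}) = UNIV"

definition tiling_space ::
    "'a set \<Rightarrow> ('a \<Rightarrow> 'a list set) \<Rightarrow> ('a \<Rightarrow> real) \<Rightarrow> 'a tile set set" where
  "tiling_space A \<theta> len =
     {S. is_tiling A len S \<and> (\<forall>x u. word_patch len x u \<subseteq> S \<longrightarrow> legal_word A \<theta> u)}"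

definition translate :: "real \<Rightarrow> 'a tile set \<Rightarrow> 'a tile set" where
  "translate t S = (\<lambda>(x, a). (x - t, a)) ` S"

definition cylinder ::
    "'a set \<Rightarrow> ('a \<Rightarrow> 'a list set) \<Rightarrow> ('a \<Rightarrow> real) \<Rightarrow> 'a tile set \<Rightarrow> real set \<Rightarrow> 'a tile set set" where
  "cylinder A \<theta> len P U = {S \<in> tiling_space A \<theta> len. \<exists>y\<in>U. P \<subseteq> translate y S}"

text \<open>For positive tile lengths, finite intersections of cylinders are unions of cylinders, so
  the cylinders are a basis of the topology they generate. The empty patch yields the whole
  space.\<close>

definition tiling_topology ::
    "'a set \<Rightarrow> ('a \<Rightarrow> 'a list set) \<Rightarrow> ('a \<Rightarrow> real) \<Rightarrow> 'a tile set topology" where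
  "tiling_topology A \<theta> len =
     topology_generated_by {cylinder A \<theta> len (word_patch len x u) U | x u U. open U}"

definition topologically_mixing :: "'x topology \<Rightarrow> (real \<Rightarrow> 'x \<Rightarrow> 'x) \<Rightarrow> bool" where
  "topologically_mixing X T \<longleftrightarrow>
     (\<forall>Z1 Z2. openin X Z1 \<and> Z1 \<noteq> {} \<and> openin X Z2 \<and> Z2 \<noteq> {} \<longrightarrow>
        (\<exists>R. \<forall>t>R. T t ` Z1 \<inter> Z2 \<noteq> {}))"

end

theory Submission
  imports Defs
begin

text \<open>Distances between tiles are lengths of legal words, so it suffices to show that these lengths
  form a uniformly discrete set: in a mixing system they would come close to every sufficiently
  large real number (\<open>not_mixing_if_lengths_uniformly_discrete\<close>). This holds for arbitrary positive
  tile lengths.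

  By compatibility, a weight \<open>g\<close> on letters, summed over a word of the substituted image of \<open>v\<close>,
  gives the sum over \<open>v\<close> of a dual weight \<open>dual g\<close>, which is \<open>g\<close> multiplied by the transposed
  substitution matrix. Cutting a prefix of an iterated image level by level into incomplete images
  of letters shows that \<open>g\<close> is bounded on legal words as soon as the dual orbit of \<open>g\<close> is summable
  (\<open>legal_weight_bounded\<close>). As all eigenvalues but one are smaller than 1 in modulus, this is the case
  for all \<open>g\<close> in a hyperplane (\<open>contracted_hyperplane\<close>). The tile lengths are not in that hyperplane,
  since supertiles are at least as long as the shortest tile. Hence for every letter \<open>b\<close> a
  combination of the indicator of \<open>b\<close> and the tile lengths is in it, so the length of a legal word
  determines its letter counts up to a bounded error (\<open>legal_words_balanced\<close>). Two legal words of
  nearly equal length therefore differ by one of finitely many integer vectors of letter counts, and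
  only finitely many small differences of lengths occur (\<open>legal_lengths_uniformly_discrete\<close>).

  A system on the empty space would be mixing, so tilings have to be exhibited. Since there is a
  second eigenvalue, there are at least two letters, and by primitivity a letter recurs strictly
  inside one of its iterated images. Nesting such images yields a bi-infinite word with legal factors
  (\<open>biinfinite_legal_word\<close>).\<close>

section \<open>A hyperplane contracted by a complex matrix\<close>

lemma summable_of_contraction:
  fixes x y :: "nat \<Rightarrow> real"
  assumes "\<And>j. 0 \<le> x j" "\<And>j. 0 \<le> y j" "0 \<le> q" "q < 1" "summable y"
    and step: "\<And>j. x (Suc j) \<le> q * x j + y j"
  shows "summable x"
proof (rule bounded_imp_summable)
  fix n
  have "(\<Sum>j\<le>n. x j) \<le> (\<Sum>j\<le>Suc n. x j)" using assms(1) by simp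
  also have "\<dots> = x 0 + (\<Sum>j\<le>n. x (Suc j))" by (rule sum.atMost_Suc_shift)
  also have "(\<Sum>j\<le>n. x (Suc j)) \<le> (\<Sum>j\<le>n. q * x j + y j)" by (intro sum_mono step)
  also have "\<dots> = q * (\<Sum>j\<le>n. x j) + (\<Sum>j\<le>n. y j)" by (simp add: sum.distrib sum_distrib_left)
  also have "(\<Sum>j\<le>n. y j) \<le> suminf y" using assms(2,5) by (intro sum_le_suminf) auto
  finally have "(1 - q) * (\<Sum>j\<le>n. x j) \<le> x 0 + suminf y" by (simp add: algebra_simps)
  thus "(\<Sum>j\<le>n. x j) \<le> (x 0 + suminf y) / (1 - q)"
    using \<open>q < 1\<close> by (simp add: pos_le_divide_eq mult.commute)
qed (rule assms(1))

lemma pow_mat_Suc_mult_vec: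
  fixes T :: "'a::semiring_1 mat"
  assumes "T \<in> carrier_mat n n" "h \<in> carrier_vec n"
  shows "(T ^\<^sub>m Suc j) *\<^sub>v h = T *\<^sub>v ((T ^\<^sub>m j) *\<^sub>v h)"
proof -
  have "T ^\<^sub>m Suc j = T * T ^\<^sub>m j"
    using assms(1) by (induction j) (auto simp: assoc_mult_mat[of _ n n _ n _ n])
  thus ?thesis using assms by (simp add: assoc_mult_mat_vec[of _ n n _ n])
qed

text \<open>Once the last coordinate of \<open>h\<close> vanishes it stays zero, so the last diagonal entry of
  \<open>T\<close> never acts and may be arbitrarily large. The coordinates are then handled from the bottom
  up: each satisfies a scalar recursion with factor \<open>T $$ (i, i)\<close>, driven by the coordinates
  below it, which are already known to be summable.\<close>

lemma upper_triangular_orbit_summable: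
  fixes T :: "complex mat" and h :: "complex vec"
  assumes T: "T \<in> carrier_mat n n" and tri: "upper_triangular T"
    and diag: "\<And>i. Suc i < n \<Longrightarrow> cmod (T $$ (i, i)) < 1"
    and h: "h \<in> carrier_vec n" and last: "0 < n \<Longrightarrow> h $ (n - 1) = 0" and "i < n"
  shows "summable (\<lambda>j. cmod (((T ^\<^sub>m j) *\<^sub>v h) $ i))"
proof -
  define x where "x j = (T ^\<^sub>m j) *\<^sub>v h" for j
  have x: "x j \<in> carrier_vec n" for j using T h by (auto simp: x_def intro!: mult_mat_vec_carrier pow_carrier_mat)
  have rec: "x (Suc j) $ i = (\<Sum>k\<in>{i..<n}. T $$ (i, k) * x j $ k)" if "i < n" for i j
  proof -
    have "x (Suc j) $ i = (\<Sum>k\<in>{0..<n}. T $$ (i, k) * x j $ k)"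
      using x[of j] T that unfolding x_def pow_mat_Suc_mult_vec[OF T h] by (simp add: scalar_prod_def)
    also have "\<dots> = (\<Sum>k\<in>{i..<n}. T $$ (i, k) * x j $ k)"
      using tri T that by (intro sum.mono_neutral_right) (auto simp: upper_triangular_def)
    finally show ?thesis .
  qed
  have last0: "x j $ (n - 1) = 0" if "0 < n" for j
  proof (induction j)
    case 0 thus ?case using h T last that by (simp add: x_def)
  next
    case (Suc j)
    have "{n - 1..<n} = {n - 1}" using that by auto
    thus ?case using rec[of "n - 1" j] that Suc by simp
  qed
  have "summable (\<lambda>j. cmod (x j $ i))"
    using \<open>i < n\<close>
  proof (induction "n - i" arbitrary: i rule: less_induct)
    case less
    show ?case
    proof (cases "Suc i = n")
      case True
      hence "x j $ i = 0" for j using last0[of j] by auto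
      thus ?thesis by simp
    next
      case False
      hence i: "Suc i < n" using less.prems by simp
      let ?y = "\<lambda>j. \<Sum>k\<in>{Suc i..<n}. cmod (T $$ (i, k)) * cmod (x j $ k)"
      have y: "summable ?y"
        by (intro summable_sum summable_mult less.hyps) (use less.prems in auto)
      have "cmod (x (Suc j) $ i) \<le> cmod (T $$ (i, i)) * cmod (x j $ i) + ?y j" for j
      proof -
        have "x (Suc j) $ i = T $$ (i, i) * x j $ i + (\<Sum>k\<in>{Suc i..<n}. T $$ (i, k) * x j $ k)"
          unfolding rec[OF less.prems] using less.prems by (simp add: sum.atLeast_Suc_lessThan)
        also have "cmod \<dots> \<le> cmod (T $$ (i, i) * x j $ i) + cmod (\<Sum>k\<in>{Suc i..<n}. T $$ (i, k) * x j $ k)"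
          by (rule norm_triangle_ineq)
        also have "cmod (\<Sum>k\<in>{Suc i..<n}. T $$ (i, k) * x j $ k) \<le> ?y j"
          by (rule sum_norm_le) (simp add: norm_mult)
        finally show ?thesis by (simp add: norm_mult)
      qed
      thus ?thesis
        by (intro summable_of_contraction[OF _ _ _ diag[OF i] y]) (auto intro!: sum_nonneg)
    qed
  qed
  thus ?thesis by (simp add: x_def)
qed

text \<open>The Schur decomposition accepts the eigenvalues in any order. With \<open>e0\<close> placed last, the
  invariant hyperplane of vectors with vanishing last Schur coordinate sees only the remaining
  eigenvalues; its equation is the last row of the inverse of the base change.\<close>

lemma contracted_hyperplane:
  fixes M :: "complex mat"
  assumes M: "M \<in> carrier_mat n n"
    and cp: "char_poly M = (\<Prod>a\<leftarrow>es @ [e0]. [:- a, 1:])"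
    and small: "\<And>e. e \<in> set es \<Longrightarrow> cmod e < 1"
  shows "\<exists>r\<in>carrier_vec n. \<forall>v\<in>carrier_vec n. r \<bullet> v = 0 \<longrightarrow>
           (\<forall>i<n. summable (\<lambda>j. cmod (((M ^\<^sub>m j) *\<^sub>v v) $ i)))"
proof -
  obtain T P Q where sd: "schur_decomposition M (es @ [e0]) = (T, P, Q)"
    by (metis prod_cases3)
  have wit: "similar_mat_wit M T P Q" and tri: "upper_triangular T" and diag: "diag_mat T = es @ [e0]"
    using schur_decomposition[OF M cp sd] by auto
  note W = similar_mat_witD2[OF M wit]
  have T: "T \<in> carrier_mat n n" and P: "P \<in> carrier_mat n n" and Q: "Q \<in> carrier_mat n n"
    using W by auto
  have n: "n = Suc (length es)"
    using arg_cong[OF diag, of length] T by (simp add: diag_mat_def)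
  have Tdiag: "cmod (T $$ (i, i)) < 1" if "Suc i < n" for i
  proof -
    have "T $$ (i, i) = diag_mat T ! i" using T that by (simp add: diag_mat_def)
    also have "\<dots> = es ! i" using that n by (simp add: diag nth_append)
    finally show ?thesis using small that n by simp
  qed
  show ?thesis
  proof (intro bexI[of _ "row Q (n - 1)"] ballI impI allI)
    show "row Q (n - 1) \<in> carrier_vec n" using Q by (auto simp: row_carrier_vec)
    fix v i assume v: "v \<in> carrier_vec n" and 0: "row Q (n - 1) \<bullet> v = 0" and i: "i < n"
    define h where "h = Q *\<^sub>v v"
    have h: "h \<in> carrier_vec n" using Q v by (simp add: h_def)
    have "h $ (n - 1) = 0" using 0 Q n by (simp add: h_def)
    hence s: "summable (\<lambda>j. cmod (((T ^\<^sub>m j) *\<^sub>v h) $ k))" if "k < n" for k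
      using upper_triangular_orbit_summable[OF T tri Tdiag h _ that] by simp
    have Th: "(T ^\<^sub>m j) *\<^sub>v h \<in> carrier_vec n" for j
      using T h by (auto intro!: mult_mat_vec_carrier pow_carrier_mat)
    have eq: "((M ^\<^sub>m j) *\<^sub>v v) = P *\<^sub>v ((T ^\<^sub>m j) *\<^sub>v h)" for j
    proof -
      have Tj: "T ^\<^sub>m j \<in> carrier_mat n n" using T by (rule pow_carrier_mat)
      have "(P * T ^\<^sub>m j * Q) *\<^sub>v v = (P * T ^\<^sub>m j) *\<^sub>v h"
        unfolding h_def by (rule assoc_mult_mat_vec[OF mult_carrier_mat[OF P Tj] Q v])
      also have "\<dots> = P *\<^sub>v ((T ^\<^sub>m j) *\<^sub>v h)" by (rule assoc_mult_mat_vec[OF P Tj h])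
      finally show ?thesis unfolding similar_mat_wit_pow_id[OF wit, of j] .
    qed
    have idx: "(P *\<^sub>v y) $ i = (\<Sum>k\<in>{0..<n}. P $$ (i, k) * y $ k)" if "y \<in> carrier_vec n" for y
      using P that i by (simp add: scalar_prod_def)
    have expand: "((M ^\<^sub>m j) *\<^sub>v v) $ i = (\<Sum>k\<in>{0..<n}. P $$ (i, k) * ((T ^\<^sub>m j) *\<^sub>v h) $ k)" for j
      unfolding eq by (rule idx[OF Th])
    have le: "cmod (((M ^\<^sub>m j) *\<^sub>v v) $ i)
        \<le> (\<Sum>k\<in>{0..<n}. cmod (P $$ (i, k)) * cmod (((T ^\<^sub>m j) *\<^sub>v h) $ k))" for j
      unfolding expand by (rule sum_norm_le) (simp only: norm_mult order_refl)
    have "summable (\<lambda>j. \<Sum>k\<in>{0..<n}. cmod (P $$ (i, k)) * cmod (((T ^\<^sub>m j) *\<^sub>v h) $ k))"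
      by (rule summable_sum, rule summable_mult, rule s) simp
    thus "summable (\<lambda>j. cmod (((M ^\<^sub>m j) *\<^sub>v v) $ i))"
      by (rule summable_comparison_test'[where N = 0]) (simp only: real_norm_def abs_norm_cancel le)
  qed
qed

text \<open>The multiset \<^const>\<open>remaining_eigenvalues\<close> lacks at most one root of the characteristic
  polynomial. For \<open>e0\<close> take the spectral radius if it is a root, and any root otherwise.\<close>

lemma remaining_eigenvalues_split:
  assumes M: "M \<in> carrier_mat n n" "0 < n"
  shows "\<exists>es e0. char_poly (map_mat of_nat M :: complex mat) = (\<Prod>a\<leftarrow>es @ [e0]. [:- a, 1:])
     \<and> set es \<subseteq> set_mset (remaining_eigenvalues M)"
proof -
  let ?M = "map_mat of_nat M :: complex mat"
  have C: "?M \<in> carrier_mat n n" using M by simp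
  obtain as where as: "char_poly ?M = (\<Prod>a\<leftarrow>as. [:- a, 1:])" "length as = n"
    using char_poly_factorized[OF C] by auto
  have proots: "proots (\<Prod>a\<leftarrow>as. [:- a, 1:]) = mset as"  for as :: "complex list"
  proof (induction as)
    case (Cons a as)
    have "proots ([:- a, 1:] * (\<Prod>a\<leftarrow>as. [:- a, 1:])) = proots [:- a, 1:] + proots (\<Prod>a\<leftarrow>as. [:- a, 1:])"
      by (rule proots_mult) (auto simp: prod_list_zero_iff)
    thus ?case unfolding list.map prod_list.Cons Cons.IH by simp
  qed simp
  define \<rho> where "\<rho> = complex_of_real (perron_frobenius_eigenvalue M)"
  have rem: "remaining_eigenvalues M = mset as - {#\<rho>#}"
    unfolding remaining_eigenvalues_def as(1) proots \<rho>_def ..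
  define e0 where "e0 = (if \<rho> \<in> set as then \<rho> else hd as)"
  have e0: "e0 \<in> set as" using as(2) M(2) by (auto simp: e0_def)
  define es where "es = remove1 e0 as"
  have m: "mset (es @ [e0]) = mset as" using e0 by (simp add: es_def)
  have img: "(\<Prod>a\<leftarrow>xs. [:- a, 1:]) = prod_mset (image_mset (\<lambda>a. [:- a, 1:]) (mset xs))" for xs :: "complex list"
    by (simp only: mset_map[symmetric] prod_mset_prod_list)
  have prod: "(\<Prod>a\<leftarrow>as. [:- a, 1:]) = (\<Prod>a\<leftarrow>es @ [e0]. [:- a, 1:])"
    by (simp only: img m)
  have "set es \<subseteq> set_mset (mset as - {#\<rho>#})"
  proof (cases "\<rho> \<in> set as")
    case True
    thus ?thesis by (simp add: es_def e0_def flip: mset_remove1)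
  next
    case False
    hence "mset as - {#\<rho>#} = mset as" by (simp add: diff_single_trivial)
    thus ?thesis using set_remove1_subset[of e0 as] by (simp add: es_def)
  qed
  thus ?thesis unfolding as(1) rem by (intro exI[of _ es] exI[of _ e0] conjI prod)
qed

text \<open>A one-letter alphabet has a single eigenvalue, the Perron--Frobenius one. Excluding this case is
  needed for the existence of tilings: for \<open>a \<mapsto> a\<close> there are none.\<close>

lemma remaining_eigenvalues_dim_ge_2:
  assumes M: "M \<in> carrier_mat n n" and "\<mu> \<in># remaining_eigenvalues M"
  shows "2 \<le> n"
proof (rule ccontr)
  let ?M = "map_mat of_nat M :: complex mat"
  have C: "?M \<in> carrier_mat n n" using M by simp
  assume "\<not> 2 \<le> n"
  hence "upper_triangular ?M" using M by (auto simp: upper_triangular_def)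
  hence cp: "char_poly ?M = (\<Prod>a\<leftarrow>diag_mat ?M. [:- a, 1:])"
    by (rule char_poly_upper_triangular[OF C])
  show False
  proof (cases "n = 0")
    case True
    hence "diag_mat ?M = []" using M by (simp add: diag_mat_def)
    thus False using assms(2) cp by (simp add: remaining_eigenvalues_def)
  next
    case False
    hence n: "n = 1" using \<open>\<not> 2 \<le> n\<close> by simp
    define m where "m = M $$ (0, 0)"
    have "diag_mat ?M = [of_nat m]" using M n by (simp add: diag_mat_def m_def)
    hence cp': "char_poly ?M = [:- of_nat m, 1:]" using cp by simp
    have "spectrum ?M = {of_nat m}"
      unfolding spectrum_root_char_poly[OF C] cp' by auto
    hence "perron_frobenius_eigenvalue M = of_nat m"
      by (simp add: perron_frobenius_eigenvalue_def spectral_radius_def)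
    thus False using assms(2) cp' by (simp add: remaining_eigenvalues_def)
  qed
qed

section \<open>Weights of words\<close>

abbreviation weight :: "('a \<Rightarrow> 'b::comm_monoid_add) \<Rightarrow> 'a list \<Rightarrow> 'b" where
  "weight g u \<equiv> sum_list (map g u)"

lemma weight_eq_sum_count:
  fixes g :: "'a \<Rightarrow> 'b::semiring_1"
  assumes "finite A" "u \<in> lists A"
  shows "weight g u = (\<Sum>b\<in>A. of_nat (count_list u b) * g b)"
  using assms(2)
proof (induction u)
  case (Cons a u)
  have "(\<Sum>b\<in>A. of_nat (count_list (a # u) b) * g b)
      = (\<Sum>b\<in>A. of_nat (count_list u b) * g b + (if b = a then g b else 0))"
    by (intro sum.cong) (auto simp: distrib_right add.commute)
  also have "\<dots> = (\<Sum>b\<in>A. of_nat (count_list u b) * g b) + g a"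
    using Cons.hyps \<open>finite A\<close> by (simp add: sum.distrib)
  finally show ?case using Cons by (simp add: add.commute)
qed simp

lemma weight_indicator:
  "weight (\<lambda>c. if c = b then 1 else 0 :: 'b::semiring_1) u = of_nat (count_list u b)"
  by (induction u) (auto simp: add.commute)

lemma norm_weight_le:
  fixes g :: "'a \<Rightarrow> complex"
  assumes "finite A" "u \<in> lists A"
  shows "cmod (weight g u) \<le> real (length u) * (\<Sum>c\<in>A. cmod (g c))"
  using assms(2)
proof (induction u)
  case (Cons a u)
  have "cmod (g a) \<le> (\<Sum>c\<in>A. cmod (g c))"
    using Cons.hyps assms(1) by (intro member_le_sum) auto
  moreover have "cmod (g a + weight g u) \<le> cmod (g a) + cmod (weight g u)"
    by (rule norm_triangle_ineq)
  ultimately show ?case using Cons.IH by (simp add: algebra_simps)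
qed simp

section \<open>Iterated substitution of words\<close>

lemma subst_word_Nil [simp]: "subst_word \<theta> [] = {[]}"
  by (simp add: subst_word_def)

lemma subst_word_Cons:
  "subst_word \<theta> (a # v) = {x @ y | x y. x \<in> \<theta> a \<and> y \<in> subst_word \<theta> v}"
  by (fastforce simp: subst_word_def set_Cons_def image_iff)

lemma subst_word_append:
  "subst_word \<theta> (u @ v) = {x @ y | x y. x \<in> subst_word \<theta> u \<and> y \<in> subst_word \<theta> v}"
proof (induction u)
  case (Cons a u)
  show ?case
    unfolding append_Cons subst_word_Cons Cons.IH
    by (auto simp: ) (metis append_assoc)+
qed simp

abbreviation iterated_subst :: "('a \<Rightarrow> 'a list set) \<Rightarrow> nat \<Rightarrow> 'a list \<Rightarrow> 'a list set" where
  "iterated_subst \<theta> k u \<equiv> (subst_set \<theta> ^^ k) {u}"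

lemma iterated_subst_Suc:
  "iterated_subst \<theta> (Suc k) u = (\<Union>w\<in>iterated_subst \<theta> k u. subst_word \<theta> w)"
  by (simp add: subst_set_def)

lemma funpow_subst_set:
  "(subst_set \<theta> ^^ k) B = (\<Union>u\<in>B. iterated_subst \<theta> k u)"
  by (induction k) (auto simp: subst_set_def)

lemma iterated_subst_add:
  "iterated_subst \<theta> (j + k) u = (\<Union>w\<in>iterated_subst \<theta> j u. iterated_subst \<theta> k w)"
  by (subst add.commute) (simp only: funpow_add o_apply funpow_subst_set[of k \<theta> "iterated_subst \<theta> j u"])

lemma iterated_subst_append:
  "iterated_subst \<theta> k (u @ v)
    = {x @ y | x y. x \<in> iterated_subst \<theta> k u \<and> y \<in> iterated_subst \<theta> k v}"
proof (induction k)
  case (Suc k)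
  show ?case (is "?L = ?R")
  proof
    show "?L \<subseteq> ?R"
      unfolding iterated_subst_Suc Suc.IH by (auto simp: subst_word_append) blast
    show "?R \<subseteq> ?L"
    proof
      fix w assume "w \<in> ?R"
      then obtain x y x' y' where "w = x @ y" "x \<in> subst_word \<theta> x'" "y \<in> subst_word \<theta> y'"
        "x' \<in> iterated_subst \<theta> k u" "y' \<in> iterated_subst \<theta> k v"
        unfolding iterated_subst_Suc by blast
      thus "w \<in> ?L"
        unfolding iterated_subst_Suc Suc.IH
        by (intro UN_I[of "x' @ y'"]) (auto simp: subst_word_append)
    qed
  qed
qed simp

text \<open>A prefix of a substituted word consists of the substituted image of a prefix followed by an
  incomplete image \<open>p\<close> of a single letter. Iterating this is the numeration by prefixes behind the
  bound on legal words.\<close>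

lemma prefix_subst_word_decomp:
  assumes "w \<in> subst_word \<theta> v" "prefix u w"
  shows "\<exists>v' c x p. prefix v' v \<and> x \<in> subst_word \<theta> v' \<and> u = x @ p \<and>
           (p = [] \<or> (c \<in> set v \<and> (\<exists>y\<in>\<theta> c. prefix p y)))"
  using assms
proof (induction v arbitrary: w u)
  case (Cons a v)
  obtain x y where w: "w = x @ y" "x \<in> \<theta> a" "y \<in> subst_word \<theta> v"
    using Cons.prems(1) by (auto simp: subst_word_Cons)
  show ?case
  proof (cases "prefix u x")
    case True
    thus ?thesis using w by (intro exI[of _ "[]"] exI[of _ a] exI[of _ u]) auto
  next
    case False
    then obtain u' where u': "u = x @ u'" "prefix u' y"
      using Cons.prems(2) w(1) by (auto simp: prefix_append)
    obtain v' c z p where *: "prefix v' v" "z \<in> subst_word \<theta> v'" "u' = z @ p"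
      "p = [] \<or> (c \<in> set v \<and> (\<exists>y\<in>\<theta> c. prefix p y))"
      using Cons.IH[OF w(3) u'(2)] by blast
    show ?thesis
      by (intro exI[of _ "a # v'"] exI[of _ c] exI[of _ "x @ z"] exI[of _ p])
        (use * w u' in \<open>auto simp: subst_word_Cons\<close>)
  qed
qed simp

section \<open>The dual action on letter weights and the bound on legal words\<close>

locale compatible_random_substitution =
  fixes A :: "'a set" and \<theta> :: "'a \<Rightarrow> 'a list set"
  assumes random_subst: "random_substitution A \<theta>"
    and compat: "compatible A \<theta>"
begin

lemma finite_alphabet: "finite A"
  and image_nonempty: "a \<in> A \<Longrightarrow> \<theta> a \<noteq> {}"
  and finite_image: "a \<in> A \<Longrightarrow> finite (\<theta> a)"
  and image_lists: "a \<in> A \<Longrightarrow> w \<in> \<theta> a \<Longrightarrow> w \<in> lists A"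
  and image_not_Nil: "a \<in> A \<Longrightarrow> w \<in> \<theta> a \<Longrightarrow> w \<noteq> []"
  using random_subst unfolding random_substitution_def by auto

lemma subst_word_nonempty: "v \<in> lists A \<Longrightarrow> subst_word \<theta> v \<noteq> {}"
proof (induction v)
  case (Cons a v)
  thus ?case using image_nonempty[of a] by (auto simp: subst_word_Cons)
qed simp

lemma subst_word_lists: "v \<in> lists A \<Longrightarrow> w \<in> subst_word \<theta> v \<Longrightarrow> w \<in> lists A"
proof (induction v arbitrary: w)
  case (Cons a v)
  then obtain x y where "w = x @ y" "x \<in> \<theta> a" "y \<in> subst_word \<theta> v"
    by (auto simp: subst_word_Cons)
  moreover from this have "x \<in> lists A" "y \<in> lists A"
    using Cons image_lists[of a x] by auto
  ultimately show ?case by simp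
qed simp

lemma length_subst_word: "v \<in> lists A \<Longrightarrow> w \<in> subst_word \<theta> v \<Longrightarrow> length v \<le> length w"
proof (induction v arbitrary: w)
  case (Cons a v)
  then obtain x y where w: "w = x @ y" "x \<in> \<theta> a" "y \<in> subst_word \<theta> v"
    by (auto simp: subst_word_Cons)
  have "length x \<ge> 1" using image_not_Nil[OF _ w(2)] Cons.prems by (cases x) auto
  thus ?case using Cons.IH[OF _ w(3)] Cons.prems w(1) by auto
qed simp

lemma iterated_subst_lists:
  "v \<in> lists A \<Longrightarrow> w \<in> iterated_subst \<theta> k v \<Longrightarrow> w \<in> lists A"
proof (induction k arbitrary: w)
  case (Suc k)
  thus ?case unfolding iterated_subst_Suc using subst_word_lists by blast
qed simp

lemma iterated_subst_nonempty: "v \<in> lists A \<Longrightarrow> iterated_subst \<theta> k v \<noteq> {}"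
proof (induction k)
  case (Suc k)
  then obtain w where "w \<in> iterated_subst \<theta> k v" by auto
  with Suc.prems show ?case
    using subst_word_nonempty[OF iterated_subst_lists] unfolding iterated_subst_Suc by fastforce
qed simp

lemma length_iterated_subst:
  "v \<in> lists A \<Longrightarrow> w \<in> iterated_subst \<theta> k v \<Longrightarrow> length v \<le> length w"
proof (induction k arbitrary: w)
  case (Suc k)
  then obtain y where y: "y \<in> iterated_subst \<theta> k v" "w \<in> subst_word \<theta> y"
    unfolding iterated_subst_Suc by auto
  show ?case
    using Suc.IH[OF Suc.prems(1) y(1)] length_subst_word[OF iterated_subst_lists[OF Suc.prems(1) y(1)] y(2)]
    by simp
qed simp

text \<open>Pulling back letter weights along the substitution: in coordinates this is the transpose of the
  substitution matrix. By compatibility the choice of the word does not matter on the alphabet.\<close>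

definition dual :: "('a \<Rightarrow> 'b::semiring_1) \<Rightarrow> 'a \<Rightarrow> 'b" where
  "dual g c = weight g (SOME w. w \<in> \<theta> c)"

lemma weight_image:
  assumes "c \<in> A" "w \<in> \<theta> c"
  shows "weight g w = dual g c"
proof -
  let ?v = "SOME w. w \<in> \<theta> c"
  have v: "?v \<in> \<theta> c" using assms(2) by (rule someI)
  have "count_list w b = count_list ?v b" if "b \<in> A" for b
    using compat assms v that unfolding compatible_def by blast
  thus ?thesis
    unfolding dual_def weight_eq_sum_count[OF finite_alphabet image_lists[OF assms]]
      weight_eq_sum_count[OF finite_alphabet image_lists[OF assms(1) v]] by simp
qed

lemma weight_subst_word:
  "v \<in> lists A \<Longrightarrow> w \<in> subst_word \<theta> v \<Longrightarrow> weight g w = weight (dual g) v"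
proof (induction v arbitrary: w)
  case (Cons a v)
  then obtain x y where "w = x @ y" "x \<in> \<theta> a" "y \<in> subst_word \<theta> v"
    by (auto simp: subst_word_Cons)
  moreover from this have "weight g x = dual g a" "weight g y = weight (dual g) v"
    using Cons weight_image[of a x g] by auto
  ultimately show ?case by simp
qed simp

lemma weight_iterated_subst:
  "v \<in> lists A \<Longrightarrow> w \<in> iterated_subst \<theta> k v \<Longrightarrow> weight g w = weight ((dual ^^ k) g) v"
proof (induction k arbitrary: w g)
  case (Suc k)
  then obtain y where y: "y \<in> iterated_subst \<theta> k v" "w \<in> subst_word \<theta> y"
    unfolding iterated_subst_Suc by auto
  have "weight g w = weight (dual g) y"
    using weight_subst_word[OF iterated_subst_lists[OF Suc.prems(1) y(1)] y(2)] .
  also have "\<dots> = weight ((dual ^^ k) (dual g)) v" by (rule Suc.IH[OF Suc.prems(1) y(1)])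
  finally show ?case by (simp add: funpow_swap1)
qed simp

lemma bounded_image_length: "\<exists>L\<ge>1. \<forall>c\<in>A. \<forall>w\<in>\<theta> c. length w \<le> L"
proof -
  let ?X = "length ` (\<Union>c\<in>A. \<theta> c)"
  have "finite ?X" using finite_alphabet finite_image by auto
  hence "\<forall>x\<in>?X. x \<le> Suc (Max ?X)" using Max_ge le_SucI by blast
  thus ?thesis by (intro exI[of _ "Suc (Max ?X)"]) auto
qed

text \<open>Peeling off one level at a time, a prefix at level \<open>k\<close> contributes an incomplete image, weighed
  by \<open>g\<close>, and a prefix at level \<open>k - 1\<close>, weighed by \<open>dual g\<close>. An incomplete image has at most
  \<open>L\<close> letters.\<close>

lemma prefix_weight_bound:
  fixes g :: "'a \<Rightarrow> complex"
  assumes "\<forall>c\<in>A. \<forall>w\<in>\<theta> c. length w \<le> L" "1 \<le> L" "a \<in> A"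
    and "w \<in> iterated_subst \<theta> k [a]" "prefix u w"
  shows "cmod (weight g u) \<le> (\<Sum>j\<le>k. real L * (\<Sum>c\<in>A. cmod ((dual ^^ j) g c)))"
  using assms(4,5)
proof (induction k arbitrary: g u w)
  case 0
  hence "u \<in> lists A" "length u \<le> L" using assms(2,3) by (auto simp: prefix_Cons)
  thus ?case
    using norm_weight_le[OF finite_alphabet, of u g]
      mult_right_mono[of "real (length u)" "real L" "\<Sum>c\<in>A. cmod (g c)"]
    by (simp add: sum_nonneg)
next
  case (Suc k)
  obtain v where v: "v \<in> iterated_subst \<theta> k [a]" "w \<in> subst_word \<theta> v"
    using Suc.prems(1) unfolding iterated_subst_Suc by auto
  have vA: "v \<in> lists A" using iterated_subst_lists[OF _ v(1)] assms(3) by auto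
  obtain v' c x p where *: "prefix v' v" "x \<in> subst_word \<theta> v'" "u = x @ p"
      "p = [] \<or> (c \<in> set v \<and> (\<exists>y\<in>\<theta> c. prefix p y))"
    using prefix_subst_word_decomp[OF v(2) Suc.prems(2)] by blast
  have v'A: "v' \<in> lists A" using vA *(1) by (auto simp: prefix_def)
  have "p \<in> lists A \<and> length p \<le> L"
  proof (cases "p = []")
    case False
    then obtain y where y: "c \<in> A" "y \<in> \<theta> c" "prefix p y" using *(4) vA by auto
    thus ?thesis
      using image_lists[OF y(1,2)] assms(1) prefix_length_le[OF y(3)] by (fastforce simp: prefix_def)
  qed simp
  hence "cmod (weight g p) \<le> real L * (\<Sum>c\<in>A. cmod (g c))"
    using norm_weight_le[OF finite_alphabet, of p g]
      mult_right_mono[of "real (length p)" "real L" "\<Sum>c\<in>A. cmod (g c)"]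
    by (simp add: sum_nonneg)
  moreover have "cmod (weight (dual g) v')
      \<le> (\<Sum>j\<le>k. real L * (\<Sum>c\<in>A. cmod ((dual ^^ j) (dual g) c)))"
    by (rule Suc.IH[OF v(1) *(1)])
  moreover have "weight g u = weight (dual g) v' + weight g p"
    using weight_subst_word[OF v'A *(2), of g] *(3) by simp
  moreover have "(\<Sum>j\<le>Suc k. real L * (\<Sum>c\<in>A. cmod ((dual ^^ j) g c)))
     = real L * (\<Sum>c\<in>A. cmod (g c)) + (\<Sum>j\<le>k. real L * (\<Sum>c\<in>A. cmod ((dual ^^ j) (dual g) c)))"
    by (subst sum.atMost_Suc_shift) (simp add: funpow_swap1)
  ultimately show ?case
    using norm_triangle_ineq[of "weight (dual g) v'" "weight g p"] by simp
qed

text \<open>A legal word is the difference of two prefixes of one and the same iterated image, and for a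
  weight with summable orbit the bound on prefixes does not depend on the level.\<close>

lemma legal_weight_bounded:
  fixes g :: "'a \<Rightarrow> complex"
  assumes summ: "\<And>c. c \<in> A \<Longrightarrow> summable (\<lambda>j. cmod ((dual ^^ j) g c))"
  shows "\<exists>K. \<forall>u. legal_word A \<theta> u \<longrightarrow> cmod (weight g u) \<le> K"
proof -
  obtain L where L: "1 \<le> L" "\<forall>c\<in>A. \<forall>w\<in>\<theta> c. length w \<le> L" using bounded_image_length by blast
  let ?f = "\<lambda>j. real L * (\<Sum>c\<in>A. cmod ((dual ^^ j) g c))"
  have s: "summable ?f" by (intro summable_mult summable_sum summ)
  show ?thesis
  proof (intro exI allI impI)
    fix u assume "legal_word A \<theta> u"
    then obtain k a w where w: "a \<in> A" "w \<in> iterated_subst \<theta> k [a]" "sublist u w"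
      unfolding legal_word_def by blast
    obtain x y where xy: "w = x @ u @ y" using w(3) by (auto simp: sublist_def)
    have pre: "cmod (weight g z) \<le> suminf ?f" if "prefix z w" for z
      using prefix_weight_bound[OF L(2,1) w(1,2) that, of g]
        sum_le_suminf[OF s, of "{..k}"] by (simp add: sum_nonneg)
    have "weight g u = weight g (x @ u) - weight g x" by simp
    also have "cmod \<dots> \<le> cmod (weight g (x @ u)) + cmod (weight g x)" by (rule norm_triangle_ineq4)
    also have "\<dots> \<le> suminf ?f + suminf ?f" by (intro add_mono pre) (auto simp: xy)
    finally show "cmod (weight g u) \<le> suminf ?f + suminf ?f" .
  qed
qed

end

section \<open>Lengths of legal words\<close>

context compatible_random_substitution
begin

lemma substitution_matrix_entry:
  assumes "set as = A" "i < length as" "j < length as" "w \<in> \<theta> (as ! j)"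
  shows "substitution_matrix as \<theta> $$ (i, j) = count_list w (as ! i)"
proof -
  have "as ! i \<in> A" "as ! j \<in> A" using assms by auto
  hence "(THE n. \<forall>v\<in>\<theta> (as ! j). count_list v (as ! i) = n) = count_list w (as ! i)"
    using compat assms(4) unfolding compatible_def by (intro the_equality) (blast, metis)
  thus ?thesis using assms by (simp add: substitution_matrix_def)
qed

lemma dual_eq_matrix:
  assumes as: "distinct as" "set as = A" and j: "j < length as"
  shows "dual g (as ! j) = (\<Sum>i<length as. of_nat (substitution_matrix as \<theta> $$ (i, j)) * g (as ! i))"
proof -
  have c: "as ! j \<in> A" using as j by auto
  obtain w where w: "w \<in> \<theta> (as ! j)" using image_nonempty[OF c] by auto
  have "dual g (as ! j) = (\<Sum>b\<in>set as. of_nat (count_list w b) * g b)"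
    using weight_image[OF c w, of g] weight_eq_sum_count[OF finite_alphabet image_lists[OF c w], of g] as
    by simp
  also have "\<dots> = (\<Sum>i<length as. of_nat (count_list w (as ! i)) * g (as ! i))"
    using as by (intro sum.reindex_bij_betw[symmetric] bij_betw_nth) auto
  also have "\<dots> = (\<Sum>i<length as. of_nat (substitution_matrix as \<theta> $$ (i, j)) * g (as ! i))"
    using substitution_matrix_entry[OF as(2) _ j w] by simp
  finally show ?thesis .
qed

lemma substitution_matrix_carrier:
  "substitution_matrix as \<theta> \<in> carrier_mat (length as) (length as)"
  by (simp add: substitution_matrix_def)

lemma dual_power_eq_matrix_power:
  assumes as: "distinct as" "set as = A" and j: "j < length as"
  shows "(dual ^^ k) g (as ! j)
    = (\<Sum>i<length as. of_nat ((substitution_matrix as \<theta> ^\<^sub>m k) $$ (i, j)) * g (as ! i))"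
  using j
proof (induction k arbitrary: j)
  case 0
  have "(\<Sum>i<length as. of_nat ((substitution_matrix as \<theta> ^\<^sub>m 0) $$ (i, j)) * g (as ! i))
      = (\<Sum>i<length as. if i = j then g (as ! i) else 0)"
    using 0 substitution_matrix_carrier[of as] by (intro sum.cong) auto
  thus ?case using 0 by simp
next
  case (Suc k)
  let ?n = "length as"
  let ?M = "substitution_matrix as \<theta>"
  note C = substitution_matrix_carrier[of as]
  have "(?M ^\<^sub>m Suc k) $$ (i, j) = (\<Sum>l<?n. (?M ^\<^sub>m k) $$ (i, l) * ?M $$ (l, j))" if "i < ?n" for i
    using C pow_carrier_mat[OF C, of k] that Suc.prems by (simp add: scalar_prod_def lessThan_atLeast0)
  hence "(\<Sum>i<?n. of_nat ((?M ^\<^sub>m Suc k) $$ (i, j)) * g (as ! i))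
      = (\<Sum>i<?n. \<Sum>l<?n. of_nat ((?M ^\<^sub>m k) $$ (i, l)) * of_nat (?M $$ (l, j)) * g (as ! i))"
    by (simp add: sum_distrib_right)
  also have "\<dots> = (\<Sum>l<?n. \<Sum>i<?n. of_nat ((?M ^\<^sub>m k) $$ (i, l)) * of_nat (?M $$ (l, j)) * g (as ! i))"
    by (rule sum.swap)
  also have "\<dots> = (\<Sum>l<?n. of_nat (?M $$ (l, j)) * (dual ^^ k) g (as ! l))"
    by (intro sum.cong refl)
       (simp add: Suc.IH sum_distrib_left mult.assoc of_nat_mult[symmetric] mult.commute[of "(?M ^\<^sub>m k) $$ _"]
          del: of_nat_mult flip: mult.assoc)
  also have "\<dots> = dual ((dual ^^ k) g) (as ! j)"
    by (rule dual_eq_matrix[OF as Suc.prems, symmetric])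
  finally show ?case by simp
qed

text \<open>The functional \<open>R\<close> plays the part of the pairing of a weight with the Perron--Frobenius
  eigenvector. Its kernel is the contracted hyperplane of weights.\<close>

lemma contracted_functionals:
  assumes as: "distinct as" "set as = A" and "as \<noteq> []"
    and small: "\<forall>e\<in>#remaining_eigenvalues (substitution_matrix as \<theta>). cmod e < 1"
  shows "\<exists>R :: ('a \<Rightarrow> complex) \<Rightarrow> complex.
     (\<forall>x y g h. R (\<lambda>c. x * g c - y * h c) = x * R g - y * R h) \<and>
     (\<forall>g. R g = 0 \<longrightarrow> (\<forall>c\<in>A. summable (\<lambda>j. cmod ((dual ^^ j) g c))))"
proof -
  let ?n = "length as"
  let ?M = "substitution_matrix as \<theta>"
  let ?N = "transpose_mat (map_mat of_nat ?M :: complex mat)"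
  note C = substitution_matrix_carrier[of as]
  have N: "?N \<in> carrier_mat ?n ?n" using C by simp
  obtain es e0 where es: "char_poly (map_mat of_nat ?M :: complex mat) = (\<Prod>a\<leftarrow>es @ [e0]. [:- a, 1:])"
      "set es \<subseteq> set_mset (remaining_eigenvalues ?M)"
    using remaining_eigenvalues_split[OF C] assms(3) by auto
  have Cc: "map_mat of_nat ?M \<in> carrier_mat ?n ?n" using C by simp
  have cp: "char_poly ?N = (\<Prod>a\<leftarrow>es @ [e0]. [:- a, 1:])"
    unfolding char_poly_transpose_mat[OF Cc] by (rule es(1))
  have "cmod e < 1" if "e \<in> set es" for e using that es(2) small by blast
  from contracted_hyperplane[OF N cp this]
  obtain r where r: "r \<in> carrier_vec ?n"
    and summ: "\<forall>v\<in>carrier_vec ?n. r \<bullet> v = 0 \<longrightarrow> (\<forall>i<?n. summable (\<lambda>j. cmod (((?N ^\<^sub>m j) *\<^sub>v v) $ i)))"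
    by blast
  have hom: "semiring_hom (of_nat :: nat \<Rightarrow> complex)" by unfold_locales auto
  have pow: "?N ^\<^sub>m k = transpose_mat (map_mat of_nat (?M ^\<^sub>m k))" for k
  proof (induction k)
    case 0
    show ?case using C by (intro eq_matI) auto
  next
    case (Suc k)
    have "?N ^\<^sub>m Suc k = ?N * ?N ^\<^sub>m k"
      using N by (induction k) (auto simp: assoc_mult_mat[of _ ?n ?n _ ?n _ ?n])
    also have "\<dots> = transpose_mat (map_mat of_nat (?M ^\<^sub>m k) * map_mat of_nat ?M)"
      unfolding Suc using C by (intro transpose_mult[symmetric, of _ ?n ?n _ ?n]) auto
    also have "map_mat of_nat (?M ^\<^sub>m k) * map_mat of_nat ?M = (map_mat of_nat (?M ^\<^sub>m Suc k) :: complex mat)"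
      unfolding pow_mat.simps by (rule semiring_hom.mat_hom_mult[OF hom pow_carrier_mat[OF C] C, symmetric])
    finally show ?case .
  qed
  let ?v = "\<lambda>g::'a \<Rightarrow> complex. vec ?n (\<lambda>i. g (as ! i))"
  define R where "R g = (\<Sum>i<?n. r $ i * g (as ! i))" for g :: "'a \<Rightarrow> complex"
  have R: "r \<bullet> ?v g = R g" for g
    using r by (simp add: R_def scalar_prod_def lessThan_atLeast0)
  have orbit: "((?N ^\<^sub>m j) *\<^sub>v ?v g) $ i = (dual ^^ j) g (as ! i)" if "i < ?n" for g i j
    unfolding pow dual_power_eq_matrix_power[OF as that]
    using C that by (simp add: scalar_prod_def lessThan_atLeast0)
  show ?thesis
  proof (intro exI[of _ R] conjI allI impI ballI)
    show "R (\<lambda>c. x * g c - y * h c) = x * R g - y * R h" for x y g h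
      by (simp add: R_def sum_distrib_left sum_subtractf algebra_simps)
    fix g c assume "R g = 0" "c \<in> A"
    then obtain i where "i < ?n" "c = as ! i" using as(2) by (auto simp: in_set_conv_nth)
    thus "summable (\<lambda>j. cmod ((dual ^^ j) g c))"
      using summ[rule_format, of "?v g" i] \<open>R g = 0\<close> by (simp add: R orbit)
  qed
qed

lemma legal_word_lists:
  "legal_word A \<theta> u \<Longrightarrow> u \<in> lists A"
proof -
  assume "legal_word A \<theta> u"
  then obtain k a w where w: "a \<in> A" "w \<in> iterated_subst \<theta> k [a]" "sublist u w"
    unfolding legal_word_def by blast
  hence "w \<in> lists A" using iterated_subst_lists[of "[a]" w k] by simp
  thus ?thesis using set_mono_sublist[OF w(3)] by auto
qed

text \<open>The dual orbit of the tile lengths consists of the lengths of the supertiles, which are bounded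
  below by the shortest tile. This keeps the tile lengths out of the contracted hyperplane.\<close>

lemma length_not_contracted:
  fixes len :: "'a \<Rightarrow> real"
  assumes pos: "\<forall>a\<in>A. len a > 0" and a: "a \<in> A"
  shows "\<not> summable (\<lambda>j. cmod ((dual ^^ j) (\<lambda>c. complex_of_real (len c)) a))"
proof
  assume "summable (\<lambda>j. cmod ((dual ^^ j) (\<lambda>c. complex_of_real (len c)) a))"
  hence lim: "(\<lambda>j. cmod ((dual ^^ j) (\<lambda>c. complex_of_real (len c)) a)) \<longlonglongrightarrow> 0"
    by (rule summable_LIMSEQ_zero)
  define m where "m = Min (len ` A)"
  have m: "0 < m" "\<And>c. c \<in> A \<Longrightarrow> m \<le> len c"
  proof -
    have "A \<noteq> {}" using a by blast
    thus "0 < m" using finite_alphabet pos by (simp add: m_def)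
    show "m \<le> len c" if "c \<in> A" for c using finite_alphabet that by (simp add: m_def)
  qed
  have "m \<le> cmod ((dual ^^ j) (\<lambda>c. complex_of_real (len c)) a)" for j
  proof -
    have aA: "[a] \<in> lists A" using a by simp
    obtain w where w: "w \<in> iterated_subst \<theta> j [a]" using iterated_subst_nonempty[OF aA] by blast
    have wA: "w \<in> lists A" and "w \<noteq> []"
      using iterated_subst_lists[OF aA w] length_iterated_subst[OF aA w] by auto
    then obtain b v where bv: "w = b # v" by (cases w) auto
    have "0 \<le> weight len v"
      using wA bv pos by (intro sum_list_nonneg) (auto intro: less_imp_le)
    hence "m \<le> weight len w" using m(2)[of b] wA bv by simp
    also have "weight (\<lambda>c. complex_of_real (len c)) w = of_real (weight len w)"
      by (induction w) auto
    hence "weight len w \<le> cmod (weight (\<lambda>c. complex_of_real (len c)) w)" by simp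
    also have "weight (\<lambda>c. complex_of_real (len c)) w = (dual ^^ j) (\<lambda>c. complex_of_real (len c)) a"
      using weight_iterated_subst[OF aA w] by simp
    finally show ?thesis .
  qed
  hence "m \<le> 0" using LIMSEQ_le_const[OF lim] by blast
  thus False using m(1) by simp
qed

text \<open>The weight \<open>g\<close> compares the number of letters \<open>b\<close> with its expected value for a word of the
  given length. It is built to lie in the kernel of \<open>R\<close>, so it is bounded on legal words: up to a
  bounded error, the length of a legal word determines its letter counts. Here \<open>R len \<noteq> 0\<close> is
  what allows the letter count to be recovered from \<open>g\<close>.\<close>

lemma legal_words_balanced:
  fixes len :: "'a \<Rightarrow> real"
  assumes as: "distinct as" "set as = A" and "as \<noteq> []"
    and small: "\<forall>e\<in>#remaining_eigenvalues (substitution_matrix as \<theta>). cmod e < 1"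
    and pos: "\<forall>a\<in>A. len a > 0" and b: "b \<in> A"
  shows "\<exists>K. \<forall>u v. legal_word A \<theta> u \<longrightarrow> legal_word A \<theta> v \<longrightarrow> \<bar>weight len u - weight len v\<bar> \<le> 1 \<longrightarrow>
           \<bar>real (count_list u b) - real (count_list v b)\<bar> \<le> K"
proof -
  obtain R :: "('a \<Rightarrow> complex) \<Rightarrow> complex"
    where lin: "\<forall>x y g h. R (\<lambda>c. x * g c - y * h c) = x * R g - y * R h"
      and "\<forall>g. R g = 0 \<longrightarrow> (\<forall>c\<in>A. summable (\<lambda>j. cmod ((dual ^^ j) g c)))"
    using contracted_functionals[OF as assms(3) small] by (elim exE conjE) (rule that)
  hence summ: "\<And>g c. R g = 0 \<Longrightarrow> c \<in> A \<Longrightarrow> summable (\<lambda>j. cmod ((dual ^^ j) g c))"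
    by simp
  let ?len = "\<lambda>c. complex_of_real (len c)"
  let ?ind = "\<lambda>c. if c = b then 1 else 0 :: complex"
  define g where "g c = R ?len * ?ind c - R ?ind * ?len c" for c
  have "R ?len \<noteq> 0" using length_not_contracted[OF pos b] summ[OF _ b] by (rule contrapos_nn)
  have "R g = 0" using lin[rule_format, of "R ?len" ?ind "R ?ind" ?len] by (simp add: g_def[abs_def])
  then obtain K where K: "\<And>u. legal_word A \<theta> u \<Longrightarrow> cmod (weight g u) \<le> K"
    using legal_weight_bounded[of g, OF summ[OF \<open>R g = 0\<close>]] by blast
  have weight_g: "weight g u = R ?len * of_nat (count_list u b) - R ?ind * of_real (weight len u)" for u
    by (induction u) (auto simp: g_def algebra_simps)
  show ?thesis
  proof (intro exI allI impI)
    fix u v assume uv: "legal_word A \<theta> u" "legal_word A \<theta> v" "\<bar>weight len u - weight len v\<bar> \<le> 1"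
    have "R ?len * of_real (real (count_list u b) - real (count_list v b))
        = weight g u - weight g v + R ?ind * of_real (weight len u - weight len v)"
      by (simp add: weight_g algebra_simps)
    hence "cmod (R ?len) * \<bar>real (count_list u b) - real (count_list v b)\<bar>
        = cmod (weight g u - weight g v + R ?ind * of_real (weight len u - weight len v))"
      by (metis norm_mult norm_of_real)
    also have "\<dots> \<le> cmod (weight g u) + cmod (weight g v) + cmod (R ?ind) * \<bar>weight len u - weight len v\<bar>"
      using norm_triangle_ineq[of "weight g u - weight g v" "R ?ind * of_real (weight len u - weight len v)"]
        norm_triangle_ineq4[of "weight g u" "weight g v"]
      by (simp add: norm_mult del: of_real_diff)
    also have "\<dots> \<le> K + K + cmod (R ?ind)"
      using K[OF uv(1)] K[OF uv(2)] mult_left_mono[OF uv(3), of "cmod (R ?ind)"] by simp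
    finally show "\<bar>real (count_list u b) - real (count_list v b)\<bar> \<le> (K + K + cmod (R ?ind)) / cmod (R ?len)"
      using \<open>R ?len \<noteq> 0\<close> by (simp add: pos_le_divide_eq mult.commute)
  qed
qed

text \<open>If the lengths of two legal words differ by at most 1, the difference of their letter counts is
  an integer vector in a fixed bounded box. So only finitely many differences of absolute value at
  most 1 occur, and the smallest nonzero one is a gap.\<close>

lemma legal_lengths_uniformly_discrete:
  fixes len :: "'a \<Rightarrow> real"
  assumes as: "distinct as" "set as = A" and "as \<noteq> []"
    and small: "\<forall>e\<in>#remaining_eigenvalues (substitution_matrix as \<theta>). cmod e < 1"
    and pos: "\<forall>a\<in>A. len a > 0"
  shows "\<exists>\<delta>>0. \<forall>u v. legal_word A \<theta> u \<longrightarrow> legal_word A \<theta> v \<longrightarrow>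
           \<bar>weight len u - weight len v\<bar> < \<delta> \<longrightarrow> weight len u = weight len v"
proof -
  obtain K where K: "\<And>b u v. b \<in> A \<Longrightarrow> legal_word A \<theta> u \<Longrightarrow> legal_word A \<theta> v \<Longrightarrow>
      \<bar>weight len u - weight len v\<bar> \<le> 1 \<Longrightarrow> \<bar>real (count_list u b) - real (count_list v b)\<bar> \<le> K b"
    using legal_words_balanced[OF assms] by metis
  define F where "F = (\<lambda>f. \<Sum>b\<in>A. real_of_int (f b) * len b) ` (\<Pi>\<^sub>E b\<in>A. {- \<lfloor>K b\<rfloor>..\<lfloor>K b\<rfloor>})"
  have "finite F" using finite_alphabet by (auto simp: F_def intro!: finite_PiE)
  define \<delta> where "\<delta> = Min (insert 1 ((\<lambda>x. \<bar>x\<bar>) ` (F - {0})))"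
  have "0 < \<delta>" "\<delta> \<le> 1" "\<And>x. x \<in> F \<Longrightarrow> \<bar>x\<bar> < \<delta> \<Longrightarrow> x = 0"
    using \<open>finite F\<close> by (auto simp: \<delta>_def)
  moreover have "weight len u - weight len v \<in> F"
    if uv: "legal_word A \<theta> u" "legal_word A \<theta> v" "\<bar>weight len u - weight len v\<bar> \<le> 1" for u v
  proof -
    let ?f = "\<lambda>b\<in>A. int (count_list u b) - int (count_list v b)"
    have "?f \<in> (\<Pi>\<^sub>E b\<in>A. {- \<lfloor>K b\<rfloor>..\<lfloor>K b\<rfloor>})"
    proof (intro restrict_PiE_iff[THEN iffD2] ballI)
      fix b assume "b \<in> A"
      hence "\<bar>real (count_list u b) - real (count_list v b)\<bar> \<le> K b" using K uv by blast
      hence "\<bar>int (count_list u b) - int (count_list v b)\<bar> \<le> \<lfloor>K b\<rfloor>"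
        by (simp add: le_floor_iff)
      thus "int (count_list u b) - int (count_list v b) \<in> {- \<lfloor>K b\<rfloor>..\<lfloor>K b\<rfloor>}" by auto
    qed
    moreover have "weight len u - weight len v = (\<Sum>b\<in>A. real_of_int (?f b) * len b)"
      using weight_eq_sum_count[OF finite_alphabet legal_word_lists[OF uv(1)], of len]
        weight_eq_sum_count[OF finite_alphabet legal_word_lists[OF uv(2)], of len]
      by (simp add: sum_subtractf left_diff_distrib)
    ultimately show ?thesis unfolding F_def by blast
  qed
  ultimately have "0 < \<delta> \<and> (\<forall>u v. legal_word A \<theta> u \<longrightarrow> legal_word A \<theta> v \<longrightarrow>
           \<bar>weight len u - weight len v\<bar> < \<delta> \<longrightarrow> weight len u = weight len v)"
    by force
  thus ?thesis by blast
qed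

end

section \<open>Existence of tilings\<close>

text \<open>The words \<open>W n\<close> are aligned so that \<open>W 0\<close> starts at position 0 and each \<open>W (Suc n)\<close> extends
  \<open>W n\<close> on both sides; \<open>off n\<close> letters of \<open>W n\<close> lie to the left of the origin.\<close>

lemma nested_words_limit:
  fixes W X Y :: "nat \<Rightarrow> 'a list"
  assumes W: "\<And>n. W (Suc n) = X n @ W n @ Y n" and X: "\<And>n. X n \<noteq> []" and Y: "\<And>n. Y n \<noteq> []"
  shows "\<exists>w :: int \<Rightarrow> 'a. \<forall>i l. \<exists>m. sublist (map (\<lambda>k. w (i + int k)) [0..<l]) (W m)"
proof -
  define off where "off n = (\<Sum>k<n. length (X k))" for n
  have offS: "off (Suc n) = off n + length (X n)" for n by (simp add: off_def)
  have off_ge: "n \<le> off n" for n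
  proof (induction n)
    case (Suc n) thus ?case using X[of n] offS[of n] by (cases "X n") auto
  qed simp
  have len_ge: "off n + n \<le> length (W n)" for n
  proof (induction n)
    case 0 thus ?case by (simp add: off_def)
  next
    case (Suc n) thus ?case using Y[of n] offS[of n] by (cases "Y n") (auto simp: W)
  qed
  define w where "w i = W (Suc (nat \<bar>i\<bar>)) ! nat (i + int (off (Suc (nat \<bar>i\<bar>))))" for i
  have w: "w i = W m ! nat (i + int (off m))" if "Suc (nat \<bar>i\<bar>) \<le> m" for i m
    using that
  proof (induction m rule: dec_induct)
    case (step m)
    have "nat (i + int (off m)) < length (W m)"
      using step.hyps off_ge[of m] len_ge[of m] by linarith
    moreover have "nat (i + int (off (Suc m))) = length (X m) + nat (i + int (off m))"
      using step.hyps off_ge[of m] offS[of m] by linarith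
    ultimately show ?case using step.IH by (simp add: W nth_append)
  qed (simp add: w_def)
  show ?thesis
  proof (intro exI[of _ w] allI)
    fix i l
    define m where "m = Suc (nat \<bar>i\<bar> + l)"
    define s where "s = nat (i + int (off m))"
    have s: "int s = i + int (off m)" using off_ge[of m] by (simp add: s_def m_def)
    have sl: "s + l \<le> length (W m)" using s len_ge[of m] unfolding m_def by linarith
    have "map (\<lambda>k. w (i + int k)) [0..<l] = take l (drop s (W m))"
    proof (rule nth_equalityI)
      fix k assume "k < length (map (\<lambda>k. w (i + int k)) [0..<l])"
      hence k: "k < l" by simp
      have "Suc (nat \<bar>i + int k\<bar>) \<le> m" using k by (simp add: m_def)
      hence "w (i + int k) = W m ! nat (i + int k + int (off m))" by (rule w)
      also have "nat (i + int k + int (off m)) = s + k" using s by linarith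
      finally show "map (\<lambda>k. w (i + int k)) [0..<l] ! k = take l (drop s (W m)) ! k"
        using k sl by simp
    qed (use sl in simp)
    moreover have "sublist (take l (drop s (W m))) (W m)"
      using sublist_order.order_trans[OF sublist_take sublist_drop] by blast
    ultimately show "\<exists>m. sublist (map (\<lambda>k. w (i + int k)) [0..<l]) (W m)" by auto
  qed
qed

lemma ex_positions:
  fixes d :: "int \<Rightarrow> real"
  shows "\<exists>p :: int \<Rightarrow> real. \<forall>i. p (i + 1) = p i + d i"
proof (intro exI allI)
  fix i :: int
  let ?p = "\<lambda>i. if 0 \<le> i then \<Sum>k<nat i. d (int k) else - (\<Sum>k<nat (- i). d (- 1 - int k))"
  show "?p (i + 1) = ?p i + d i"
  proof (cases "0 \<le> i")
    case True
    hence "nat (i + 1) = Suc (nat i)" by simp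
    thus ?thesis using True by simp
  next
    case False
    hence "nat (- i) = Suc (nat (- (i + 1)))" by simp
    thus ?thesis using False by (cases "i = -1") auto
  qed
qed

lemma positions_add:
  fixes p :: "int \<Rightarrow> real"
  assumes "\<And>i. p (i + 1) = p i + len (w i)"
  shows "p (i + int l) = p i + weight len (map (\<lambda>k. w (i + int k)) [0..<l])"
proof (induction l)
  case (Suc l)
  thus ?case using assms[of "i + int l"] by (simp add: algebra_simps)
qed simp

lemma word_patch_positions:
  assumes "\<And>i. p (i + 1) = p i + len (w i)"
  shows "word_patch len (p i) (map (\<lambda>k. w (i + int k)) [0..<l]) \<subseteq> range (\<lambda>i. (p i, w i))"
proof (induction l arbitrary: i)
  case (Suc l)
  have "map (\<lambda>k. w (i + int k)) [0..<Suc l] = w i # map (\<lambda>k. w (i + 1 + int k)) [0..<l]"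
    by (simp add: upt_conv_Cons map_Suc_upt[symmetric] add.assoc del: upt_Suc map_map)
       (simp add: comp_def algebra_simps)
  thus ?case using Suc[of "i + 1"] assms[of i] by auto
qed simp

lemma positions_strict_mono:
  fixes p :: "int \<Rightarrow> real"
  assumes p: "\<And>i. p (i + 1) = p i + len (w i)" and pos: "\<And>i. len (w i) > 0"
  shows "strict_mono p"
proof (rule strict_monoI)
  fix i j :: int assume "i < j"
  thus "p i < p j"
  proof (induction j rule: int_gr_induct)
    case base thus ?case using p[of i] pos[of i] by simp
  next
    case (step j) thus ?case using p[of j] pos[of j] by simp
  qed
qed

text \<open>As the left endpoints are distinct, the patches inside a tiling are exactly the factors of its
  bi-infinite word, so legality of the factors is all that has to be checked.\<close>

lemma word_patch_subset_positions:
  assumes p: "\<And>i. p (i + 1) = p i + len (w i)" and inj: "inj p"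
    and "word_patch len (p i) u \<subseteq> range (\<lambda>i. (p i, w i))"
  shows "u = map (\<lambda>k. w (i + int k)) [0..<length u]"
  using assms(3)
proof (induction u arbitrary: i)
  case (Cons a u)
  obtain i' where "p i = p i'" "a = w i'" using Cons.prems by auto
  hence a: "a = w i" using inj by (auto dest: injD)
  hence "u = map (\<lambda>k. w (i + 1 + int k)) [0..<length u]"
    using Cons.prems p[of i] by (intro Cons.IH) simp
  moreover have "map (\<lambda>k. w (i + int k)) [0..<Suc (length u)] = w i # map (\<lambda>k. w (i + 1 + int k)) [0..<length u]"
    by (simp add: upt_conv_Cons map_Suc_upt[symmetric] add.assoc del: upt_Suc map_map)
       (simp add: comp_def algebra_simps)
  ultimately show ?case using a by simp
qed simp

lemma positions_cover:
  fixes p :: "int \<Rightarrow> real"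
  assumes p: "\<And>i. p (i + 1) = p i + d i" and d: "\<And>i. m \<le> d i" "0 < m"
  shows "\<exists>i. p i \<le> x \<and> x \<le> p (i + 1)"
proof -
  have up: "p i + m * real l \<le> p (i + int l)" for i l
  proof (induction l)
    case (Suc l)
    thus ?case using p[of "i + int l"] d(1)[of "i + int l"] by (simp add: algebra_simps)
  qed simp
  obtain N where N: "\<bar>p 0 - x\<bar> < m * real N"
    using reals_Archimedean3[OF d(2)] by (metis mult.commute)
  have lo: "p (- int N) \<le> x" using up[of "- int N" N] N by simp
  have "x < p (- int N + int (2 * N))" using up[of 0 N] N by simp
  define k where "k = (LEAST k. x < p (- int N + int k))"
  have k: "x < p (- int N + int k)" unfolding k_def by (rule LeastI) fact
  have "k \<noteq> 0" using k lo by (intro notI) simp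
  then obtain k' where k': "k = Suc k'" by (cases k) auto
  have "\<not> x < p (- int N + int k')" using not_less_Least[of k' "\<lambda>k. x < p (- int N + int k)"] k'
    by (simp add: k_def)
  thus ?thesis using k k' by (intro exI[of _ "- int N + int k'"]) (simp add: algebra_simps)
qed

lemma tiling_space_nonempty:
  fixes len :: "'a \<Rightarrow> real" and w :: "int \<Rightarrow> 'a"
  assumes "finite A" and pos: "\<forall>a\<in>A. len a > 0"
    and wA: "\<And>i. w i \<in> A" and legal: "\<And>i l. legal_word A \<theta> (map (\<lambda>k. w (i + int k)) [0..<l])"
  shows "tiling_space A \<theta> len \<noteq> {}"
proof -
  obtain p :: "int \<Rightarrow> real" where p: "\<And>i. p (i + 1) = p i + len (w i)"
    using ex_positions[of "\<lambda>i. len (w i)"] by auto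
  define S where "S = range (\<lambda>i. (p i, w i))"
  define m where "m = Min (len ` A)"
  have m: "0 < m" "\<And>i. m \<le> len (w i)"
  proof -
    have "A \<noteq> {}" using wA by blast
    thus "0 < m" using assms(1) pos by (simp add: m_def)
    show "m \<le> len (w i)" for i using assms(1) wA by (simp add: m_def)
  qed
  have inj: "inj p"
    using positions_strict_mono[of p len w, OF p] pos wA strict_mono_imp_inj_on by blast
  have cover: "(\<Union>(x, a)\<in>S. {x..x + len a}) = UNIV"
  proof (intro equalityI subset_UNIV subsetI)
    fix x :: real
    obtain i where "p i \<le> x" "x \<le> p (i + 1)" using positions_cover[of p "\<lambda>i. len (w i)" m, OF p m(2,1)] by blast
    thus "x \<in> (\<Union>(x, a)\<in>S. {x..x + len a})"
      by (intro UN_I[of "(p i, w i)"]) (auto simp: S_def p)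
  qed
  have "is_tiling A len S"
    unfolding is_tiling_def
    by (intro conjI exI[of _ w] exI[of _ p] allI cover) (auto simp: wA p S_def)
  moreover have "legal_word A \<theta> u" if u: "word_patch len x u \<subseteq> S" for x u
  proof (cases u)
    case Nil
    thus ?thesis using legal[of 0 0] by simp
  next
    case (Cons a v)
    then obtain i where "x = p i" using u by (auto simp: S_def)
    hence "u = map (\<lambda>k. w (i + int k)) [0..<length u]"
      using word_patch_subset_positions[of p len w, OF p inj] u by (simp add: S_def)
    thus ?thesis using legal[of i "length u"] by simp
  qed
  ultimately show ?thesis unfolding tiling_space_def by blast
qed

context compatible_random_substitution
begin

lemma length_iterated_subst_double:
  assumes long: "\<And>a x. a \<in> A \<Longrightarrow> x \<in> iterated_subst \<theta> k [a] \<Longrightarrow> 2 \<le> length x"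
  shows "v \<in> lists A \<Longrightarrow> w \<in> iterated_subst \<theta> k v \<Longrightarrow> 2 * length v \<le> length w"
proof (induction v arbitrary: w)
  case (Cons a v)
  then obtain x y where xy: "w = x @ y" "x \<in> iterated_subst \<theta> k [a]" "y \<in> iterated_subst \<theta> k v"
    using iterated_subst_append[of k \<theta> "[a]" v] by auto
  have "2 \<le> length x" "2 * length v \<le> length y" using long[OF _ xy(2)] Cons.IH[OF _ xy(3)] Cons.prems by auto
  thus ?case using xy(1) by simp
qed simp

text \<open>Three rounds of a full substitution are enough: after two the word has at least four letters, and
  in the third the image of its second letter contains \<open>b\<close>, with nonempty images on both sides.\<close>

lemma inner_occurrence:
  assumes full: "\<And>a w. a \<in> A \<Longrightarrow> w \<in> iterated_subst \<theta> k [a] \<Longrightarrow> A \<subseteq> set w"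
    and "2 \<le> card A" "b \<in> A"
  shows "\<exists>P S. P \<noteq> [] \<and> S \<noteq> [] \<and> P @ [b] @ S \<in> iterated_subst \<theta> (k + k + k) [b]"
proof -
  have long: "2 \<le> length w" if "a \<in> A" "w \<in> iterated_subst \<theta> k [a]" for a w
    using card_mono[OF _ full[OF that]] card_length[of w] \<open>2 \<le> card A\<close> by simp
  have bA: "[b] \<in> lists A" using \<open>b \<in> A\<close> by simp
  obtain u where u: "u \<in> iterated_subst \<theta> k [b]" using iterated_subst_nonempty[OF bA] by blast
  have uA: "u \<in> lists A" by (rule iterated_subst_lists[OF bA u])
  obtain v where v: "v \<in> iterated_subst \<theta> k u" using iterated_subst_nonempty[OF uA] by blast
  have vA: "v \<in> lists A" by (rule iterated_subst_lists[OF uA v])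
  have "4 \<le> length v"
    using length_iterated_subst_double[of k u v, OF _ uA v] long long[OF \<open>b \<in> A\<close> u] by simp
  then obtain c d v' where v': "v = [c] @ [d] @ v'" "v' \<noteq> []"
    by (cases v; cases "tl v"; cases "tl (tl v)") auto
  have cA: "[c] \<in> lists A" and dA: "[d] \<in> lists A" and v'A: "v' \<in> lists A" using vA v'(1) by auto
  obtain x y z where xyz: "x \<in> iterated_subst \<theta> k [c]" "y \<in> iterated_subst \<theta> k [d]" "z \<in> iterated_subst \<theta> k v'"
    using iterated_subst_nonempty[OF cA] iterated_subst_nonempty[OF dA] iterated_subst_nonempty[OF v'A] by blast
  have "x \<noteq> []" "z \<noteq> []"
    using length_iterated_subst[OF cA xyz(1)] length_iterated_subst[OF v'A xyz(3)] v'(2) by auto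
  have "b \<in> set y" using full[OF _ xyz(2)] dA \<open>b \<in> A\<close> by auto
  then obtain y1 y2 where y: "y = y1 @ [b] @ y2" by (auto dest: split_list)
  have "x @ y @ z \<in> iterated_subst \<theta> k v"
    unfolding v'(1) iterated_subst_append using xyz by blast
  hence "x @ y @ z \<in> iterated_subst \<theta> (k + k + k) [b]"
    unfolding iterated_subst_add using u v by blast
  thus ?thesis using y \<open>x \<noteq> []\<close> \<open>z \<noteq> []\<close>
    by (intro exI[of _ "x @ y1"] exI[of _ "y2 @ z"]) simp
qed

text \<open>Since \<open>b\<close> reappears strictly inside \<open>P @ [b] @ S\<close>, the iterated images of \<open>b\<close> can be chosen
  nested: \<open>W (Suc n)\<close> is an image of \<open>P @ [b] @ S\<close> under the \<open>n\<close>-th power in which the letter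
  \<open>b\<close> is replaced by \<open>W n\<close>.\<close>

lemma biinfinite_legal_word:
  assumes b: "b \<in> A" and "1 \<le> K" and PS: "P \<noteq> []" "S \<noteq> []" "P @ [b] @ S \<in> iterated_subst \<theta> K [b]"
  shows "\<exists>w :: int \<Rightarrow> 'a. (\<forall>i. w i \<in> A) \<and> (\<forall>i l. legal_word A \<theta> (map (\<lambda>k. w (i + int k)) [0..<l]))"
proof -
  have bA: "[b] \<in> lists A" using b by simp
  have "P @ [b] @ S \<in> lists A" by (rule iterated_subst_lists[OF bA PS(3)])
  hence PA: "P \<in> lists A" and SA: "S \<in> lists A" by auto
  obtain X where X: "\<And>n. X n \<in> iterated_subst \<theta> (n * K) P"
  proof -
    have "\<forall>n. \<exists>x. x \<in> iterated_subst \<theta> (n * K) P" using iterated_subst_nonempty[OF PA] by blast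
    thus thesis using that by metis
  qed
  obtain Y where Y: "\<And>n. Y n \<in> iterated_subst \<theta> (n * K) S"
  proof -
    have "\<forall>n. \<exists>x. x \<in> iterated_subst \<theta> (n * K) S" using iterated_subst_nonempty[OF SA] by blast
    thus thesis using that by metis
  qed
  have XY: "X n \<noteq> []" "Y n \<noteq> []" for n
    using length_iterated_subst[OF PA X] length_iterated_subst[OF SA Y] PS(1,2)
    by (metis le_zero_eq length_0_conv)+
  define W where "W = rec_nat [b] (\<lambda>n v. X n @ v @ Y n)"
  have WS: "W (Suc n) = X n @ W n @ Y n" for n by (simp add: W_def)
  have W: "W n \<in> iterated_subst \<theta> (n * K) [b]" for n
  proof (induction n)
    case (Suc n)
    have "W (Suc n) \<in> iterated_subst \<theta> (n * K) (P @ [b] @ S)"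
      unfolding WS iterated_subst_append using X[of n] Y[of n] Suc by blast
    hence "W (Suc n) \<in> iterated_subst \<theta> (K + n * K) [b]"
      unfolding iterated_subst_add using PS(3) by blast
    thus ?case by simp
  qed (simp add: W_def)
  obtain w :: "int \<Rightarrow> 'a" where w: "\<And>i l. \<exists>m. sublist (map (\<lambda>k. w (i + int k)) [0..<l]) (W m)"
    using nested_words_limit[of W X Y, OF WS XY] by blast
  have legal: "legal_word A \<theta> (map (\<lambda>k. w (i + int k)) [0..<l])" for i l
  proof -
    obtain m where "sublist (map (\<lambda>k. w (i + int k)) [0..<l]) (W m)" using w by blast
    moreover have "sublist (W m) (W (Suc m))" unfolding WS by (auto simp: sublist_def)
    ultimately have "sublist (map (\<lambda>k. w (i + int k)) [0..<l]) (W (Suc m))"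
      by (rule sublist_order.order_trans)
    moreover have "1 \<le> Suc m * K" using \<open>1 \<le> K\<close> by simp
    ultimately show ?thesis unfolding legal_word_def using W[of "Suc m"] b by blast
  qed
  moreover have "w i \<in> A" for i
  proof -
    obtain m where "sublist (map (\<lambda>k. w (i + int k)) [0..<1]) (W m)" using w by blast
    hence "w i \<in> set (W m)" by (auto dest: set_mono_sublist)
    thus ?thesis using iterated_subst_lists[OF bA W[of m]] by auto
  qed
  ultimately show ?thesis by blast
qed

end

section \<open>Failure of mixing\<close>

context compatible_random_substitution
begin

text \<open>The \<open>(i, j)\<close> entry of the matrix power counts the letters \<open>as ! i\<close> in every image of
  \<open>as ! j\<close>, so a positive column means that all letters occur.\<close>

lemma primitive_full:
  assumes as: "distinct as" "set as = A"
    and pos: "\<forall>i<length as. \<forall>j<length as. (substitution_matrix as \<theta> ^\<^sub>m k) $$ (i, j) > 0"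
    and a: "a \<in> A" and w: "w \<in> iterated_subst \<theta> k [a]"
  shows "A \<subseteq> set w"
proof
  fix b assume "b \<in> A"
  then obtain i j where i: "i < length as" "b = as ! i" and j: "j < length as" "a = as ! j"
    using a as(2) by (metis in_set_conv_nth)
  let ?ind = "\<lambda>c. if c = b then 1 else 0 :: nat"
  have "count_list w b = (dual ^^ k) ?ind (as ! j)"
    using weight_iterated_subst[OF _ w, of ?ind] a j weight_indicator[of b w, where ?'b = nat] by simp
  also have "\<dots> \<ge> (substitution_matrix as \<theta> ^\<^sub>m k) $$ (i, j) * ?ind (as ! i)"
    unfolding dual_power_eq_matrix_power[OF as j(1)] of_nat_id
    by (rule member_le_sum) (use i in auto)
  finally have "0 < count_list w b" using pos i j by (metis le_zero_eq mult_1_right neq0_conv)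
  thus "b \<in> set w" by (metis count_list_0_iff neq0_conv)
qed

end

lemma tiling_displacement_legal:
  assumes S: "S \<in> tiling_space A \<theta> len" and pos: "\<forall>a\<in>A. len a > 0"
    and tiles: "(x, a) \<in> S" "(y, b) \<in> S" and "x < y"
  shows "\<exists>u. legal_word A \<theta> u \<and> weight len u = y - x"
proof -
  obtain w :: "int \<Rightarrow> 'a" and p where wp: "\<And>i. w i \<in> A" "\<And>i. p (i + 1) = p i + len (w i)"
      and S_eq: "S = range (\<lambda>i. (p i, w i))"
    using S unfolding tiling_space_def is_tiling_def by blast
  obtain i j where ij: "x = p i" "y = p j" using tiles S_eq by auto
  have "strict_mono p" using positions_strict_mono[of p len w, OF wp(2)] pos wp(1) by blast
  hence "i < j" using \<open>x < y\<close> ij by (simp add: strict_mono_less)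
  then obtain l where l: "j = i + int l" by (metis zle_iff_zadd less_imp_le)
  let ?u = "map (\<lambda>k. w (i + int k)) [0..<l]"
  have "word_patch len (p i) ?u \<subseteq> S"
    unfolding S_eq by (rule word_patch_positions[of p len w, OF wp(2)])
  hence "legal_word A \<theta> ?u" using S unfolding tiling_space_def by blast
  moreover have "weight len ?u = y - x"
    using positions_add[of p len w i l, OF wp(2)] ij l by simp
  ultimately show ?thesis by blast
qed

lemma mem_translate: "(z, a) \<in> translate y T \<longleftrightarrow> (z + y, a) \<in> T"
  by (force simp: translate_def)

lemma openin_cylinder:
  "open U \<Longrightarrow> openin (tiling_topology A \<theta> len) (cylinder A \<theta> len (word_patch len x u) U)"
  unfolding tiling_topology_def by (intro topology_generated_by_Basis) blast

text \<open>Let \<open>Z\<close> be the set of tilings with a tile of a given label within \<open>\<epsilon>\<close> of a given place. If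
  \<open>Z\<close> meets its translate by \<open>t\<close>, some tiling has two such tiles at distance almost \<open>t\<close>, and
  the word between them is legal with length almost \<open>t\<close>. Mixing would produce such lengths near
  every large \<open>t\<close>, in particular two distinct ones at distance about half the gap.\<close>

lemma not_mixing_if_lengths_uniformly_discrete:
  fixes len :: "'a \<Rightarrow> real"
  assumes nonempty: "tiling_space A \<theta> len \<noteq> {}" and pos: "\<forall>a\<in>A. len a > 0"
    and "0 < \<delta>"
    and gap: "\<And>u v. legal_word A \<theta> u \<Longrightarrow> legal_word A \<theta> v \<Longrightarrow>
           \<bar>weight len u - weight len v\<bar> < \<delta> \<Longrightarrow> weight len u = weight len v"
  shows "\<not> topologically_mixing (tiling_topology A \<theta> len) translate"
proof
  assume mix: "topologically_mixing (tiling_topology A \<theta> len) translate"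
  \<comment> \<open>Each length is only known up to \<open>2 * \<epsilon>\<close>. This choice keeps the difference of two lengths
    near \<open>t\<close> and \<open>t + \<delta> / 2\<close> between \<open>\<delta> / 4\<close> and \<open>3 * \<delta> / 4\<close>.\<close>
  define \<epsilon> where "\<epsilon> = \<delta> / 16"
  have "0 < \<epsilon>" using \<open>0 < \<delta>\<close> by (simp add: \<epsilon>_def)
  obtain S where S: "S \<in> tiling_space A \<theta> len" using nonempty by blast
  then obtain x a where xa: "(x, a) \<in> S" unfolding tiling_space_def is_tiling_def by blast
  define Z where "Z = cylinder A \<theta> len (word_patch len x [a]) {-\<epsilon><..<\<epsilon>}"
  have Z_iff: "T \<in> Z \<longleftrightarrow> T \<in> tiling_space A \<theta> len \<and> (\<exists>y. \<bar>y\<bar> < \<epsilon> \<and> (x + y, a) \<in> T)" for T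
    unfolding Z_def cylinder_def by (auto simp: mem_translate abs_less_iff)
  have "openin (tiling_topology A \<theta> len) Z" unfolding Z_def by (intro openin_cylinder) simp
  moreover have "S \<in> Z" unfolding Z_iff using S xa \<open>0 < \<epsilon>\<close> by (intro conjI exI[of _ 0]) auto
  ultimately obtain R where R: "\<And>t. R < t \<Longrightarrow> translate t ` Z \<inter> Z \<noteq> {}"
    using mix unfolding topologically_mixing_def by blast
  have near: "\<exists>u. legal_word A \<theta> u \<and> \<bar>weight len u - t\<bar> < 2 * \<epsilon>" if t: "R < t" "2 * \<epsilon> < t" for t
  proof -
    obtain T where T: "T \<in> Z" "translate t T \<in> Z" using R[OF t(1)] by blast
    obtain y where y: "\<bar>y\<bar> < \<epsilon>" "(x + y, a) \<in> T" using T(1) unfolding Z_iff by blast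
    obtain y' where y': "\<bar>y'\<bar> < \<epsilon>" "(x + y', a) \<in> translate t T" using T(2) unfolding Z_iff by blast
    hence "(x + y' + t, a) \<in> T" by (simp add: mem_translate)
    moreover have "x + y < x + y' + t" using y(1) y'(1) t(2) by linarith
    ultimately obtain u where "legal_word A \<theta> u" "weight len u = x + y' + t - (x + y)"
      using tiling_displacement_legal[of T A \<theta> len "x + y" a] T(1) pos y(2) unfolding Z_iff by blast
    thus ?thesis using y(1) y'(1) by (intro exI[of _ u]) linarith
  qed
  define t where "t = max R (2 * \<epsilon>) + 1"
  have t: "R < t" "2 * \<epsilon> < t" unfolding t_def by linarith+
  obtain u where u: "legal_word A \<theta> u" "\<bar>weight len u - t\<bar> < 2 * \<epsilon>"
    using near[OF t] by blast
  have "R < t + \<delta> / 2" "2 * \<epsilon> < t + \<delta> / 2" using t \<open>0 < \<delta>\<close> by linarith+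
  then obtain v where v: "legal_word A \<theta> v" "\<bar>weight len v - (t + \<delta> / 2)\<bar> < 2 * \<epsilon>"
    using near by blast
  have "\<bar>weight len u - weight len v\<bar> < \<delta>" "weight len u \<noteq> weight len v"
    using u(2) v(2) \<open>0 < \<delta>\<close> unfolding \<epsilon>_def by linarith+
  thus False using gap u(1) v(1) by blast
qed

theorem theorem45:
  fixes as :: "'a list"
    and \<theta> :: "'a \<Rightarrow> 'a list set"
    and len :: "'a \<Rightarrow> real"
    and \<mu> :: complex
  assumes "distinct as"
    and "random_substitution (set as) \<theta>"
    and "compatible (set as) \<theta>"
    and "primitive_substitution as \<theta>"
    and "second_eigenvalue (substitution_matrix as \<theta>) \<mu>"
    and "cmod \<mu> < 1"
    and "\<forall>a\<in>set as. len a > 0"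
  shows "\<not> topologically_mixing (tiling_topology (set as) \<theta> len) translate"
proof -
  interpret compatible_random_substitution "set as" \<theta>
    using assms(2,3) by unfold_locales
  let ?M = "substitution_matrix as \<theta>"
  have small: "\<forall>e\<in>#remaining_eigenvalues ?M. cmod e < 1"
    using assms(5,6) unfolding second_eigenvalue_def by force
  have n: "2 \<le> length as"
    using remaining_eigenvalues_dim_ge_2[OF substitution_matrix_carrier] assms(5)
    unfolding second_eigenvalue_def by blast
  hence "as \<noteq> []" by auto
  obtain k where k: "1 \<le> k" "\<forall>i<length as. \<forall>j<length as. (?M ^\<^sub>m k) $$ (i, j) > 0"
    using assms(4) unfolding primitive_substitution_def by blast
  obtain b where b: "b \<in> set as" using \<open>as \<noteq> []\<close> by (cases as) auto
  have "2 \<le> card (set as)" using n assms(1) by (simp add: distinct_card)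
  hence "\<exists>P S. P \<noteq> [] \<and> S \<noteq> [] \<and> P @ [b] @ S \<in> iterated_subst \<theta> (k + k + k) [b]"
    by (intro inner_occurrence[OF _ _ b] primitive_full[OF assms(1) refl k(2)])
  then obtain P S where PS: "P \<noteq> []" "S \<noteq> []" "P @ [b] @ S \<in> iterated_subst \<theta> (k + k + k) [b]"
    by blast
  have "1 \<le> k + k + k" using k(1) by simp
  from biinfinite_legal_word[OF b this PS]
  obtain w :: "int \<Rightarrow> 'a" where w: "\<And>i. w i \<in> set as"
      "\<And>i l. legal_word (set as) \<theta> (map (\<lambda>k. w (i + int k)) [0..<l])"
    by blast
  \<comment> \<open>On an empty space mixing holds vacuously.\<close>
  have nonempty: "tiling_space (set as) \<theta> len \<noteq> {}"
    by (rule tiling_space_nonempty[OF finite_alphabet assms(7) w])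
  obtain \<delta> where "0 < \<delta>" and gap: "\<forall>u v. legal_word (set as) \<theta> u \<longrightarrow> legal_word (set as) \<theta> v \<longrightarrow>
           \<bar>weight len u - weight len v\<bar> < \<delta> \<longrightarrow> weight len u = weight len v"
    using legal_lengths_uniformly_discrete[OF assms(1) refl \<open>as \<noteq> []\<close> small assms(7)] by blast
  thus ?thesis
    using not_mixing_if_lengths_uniformly_discrete[OF nonempty assms(7) \<open>0 < \<delta>\<close>] by simp
qed

end
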